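(* Let $\beta>0$. For any policy $\tilde d^*\in\mathcal D$, every policy $d\in\mathcal D$ lying in one of the following two areas is dominated by $\tilde d^*$, i.e. satisfies $\beta\sigma^{\tilde d^*}-\mu^{\tilde d^*}\le\beta\sigma^d-\mu^d$: (1) policies $d$ with $\mu^d\in(-\infty,\ \mu^{\tilde d^*}-\beta\sigma^{\tilde d^*}]$; (2) policies $d$ with $\mu^d\in[\mu^{\tilde d^*}-\beta\sigma^{\tilde d^*},\ +\infty)$ and $\sigma^d\in\big[\sigma^{\tilde d^*}+\tfrac1\beta(\mu^d-\mu^{\tilde d^*}),\ +\infty\big)$.
   Context: MDP setting. $\mathcal S=\{1,\dots,S\}$ is a finite state space, $\mathcal A$ is a finite nonempty action space, $p(j|i,a)$ is the probability of moving from state $i$ to state $j$ under action $a$, and $r(i,a)\in\mathbb R$ is the reward. $\mathcal D$ is the (finite) set of stationary deterministic policies $d:\mathcal S\to\mathcal A$. For $d\in\mathcal D$, $\bm P^d$ is the $S\times S$ transition matrix with entries $p(j|i,d(i))$. Standing assumption: for every $d\in\mathcal D$ the Markov chain with matrix $\bm P^d$ is a unichain (a single recurrent class plus possibly transient states), so it has a unique stationary distribution $\bm\pi^d=(\pi^d(i))_{i\in\mathcal S}$, with $\bm\pi^d\bm P^d=\bm\pi^d$ and $\sum_i\pi^d(i)=1$. Long-run mean: $\mu^d=\sum_{i\in\mathcal S}\pi^d(i)\,r(i,d(i))$. Long-run (steady-state) variance: $\sigma^d=\sum_{i\in\mathcal S}\pi^d(i)\,(r(i,d(i))-\mu^d)^2$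 (note that $\sigma^d$ denotes the variance itself). The objective being minimized over $\mathcal D$ is $\beta\sigma^d-\mu^d$. *)

theory Defs
  imports "HOL-Probability.Probability"
begin

text \<open>
  States and actions are the elements of finite types \<open>'s\<close> and \<open>'a\<close>; since types are
  inhabited, both spaces are nonempty.  The kernel \<open>p i a\<close> is the distribution of the next
  state, so \<open>p(j|i,a)\<close> is \<open>pmf (p i a) j\<close>.
\<close>

type_synonym ('s, 'a) policy = "'s \<Rightarrow> 'a"

definition trans_mat ::
    "('s::finite \<Rightarrow> 'a::finite \<Rightarrow> 's pmf) \<Rightarrow> ('s, 'a) policy \<Rightarrow> real ^ 's ^ 's" where
  "trans_mat p d = (\<chi> i j. pmf (p i (d i)) j)"

text \<open>
  The operation \<open>^\<close> on \<open>real ^ 's ^ 's\<close> is the entrywise power, hence the explicit definition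
  of the \<open>n\<close>-step transition matrix.
\<close>

primrec n_step :: "real ^ 's ^ 's \<Rightarrow> nat \<Rightarrow> real ^ 's ^ ('s::finite)" where
  "n_step P 0 = mat 1"
| "n_step P (Suc n) = P ** n_step P n"

definition accessible :: "real ^ 's ^ 's \<Rightarrow> ('s::finite) \<Rightarrow> 's \<Rightarrow> bool" where
  "accessible P i j \<longleftrightarrow> (\<exists>n. n_step P n $ i $ j > 0)"

definition communication :: "real ^ 's ^ 's \<Rightarrow> (('s::finite) \<times> 's) set" where
  "communication P = {(i, j). accessible P i j \<and> accessible P j i}"

text \<open>
  \<open>first_visit P n $ i $ j\<close> is the probability that the chain started in \<open>i\<close> visits \<open>j\<close> for the
  first time (not counting time \<open>0\<close>) at time \<open>n + 1\<close>.
\<close>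

primrec first_visit :: "real ^ 's ^ 's \<Rightarrow> nat \<Rightarrow> real ^ 's ^ ('s::finite)" where
  "first_visit P 0 = P"
| "first_visit P (Suc n) = (\<chi> i j. \<Sum>k\<in>UNIV - {j}. P $ i $ k * first_visit P n $ k $ j)"

text \<open>A state is recurrent if the chain returns to it with probability \<open>1\<close>, else transient.\<close>

definition recurrent :: "real ^ 's ^ 's \<Rightarrow> ('s::finite) \<Rightarrow> bool" where
  "recurrent P i \<longleftrightarrow> (\<lambda>n. first_visit P n $ i $ i) sums 1"

text \<open>
  The recurrent states form exactly one communicating class (in particular there is one);
  all remaining states are transient.
\<close>

definition unichain :: "real ^ 's ^ ('s::finite) \<Rightarrow> bool" where
  "unichain P \<longleftrightarrow> {i. recurrent P i} \<in> UNIV // communication P"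

definition stationary_distribution :: "real ^ 's ^ 's \<Rightarrow> real ^ ('s::finite) \<Rightarrow> bool" where
  "stationary_distribution P x \<longleftrightarrow>
     (\<forall>i. 0 \<le> x $ i) \<and> (\<Sum>i\<in>UNIV. x $ i) = 1 \<and> x v* P = x"

text \<open>Meaningful when the stationary distribution is unique, as it is for unichains.\<close>

definition stat_dist ::
    "('s::finite \<Rightarrow> 'a::finite \<Rightarrow> 's pmf) \<Rightarrow> ('s, 'a) policy \<Rightarrow> real ^ 's" where
  "stat_dist p d = (THE x. stationary_distribution (trans_mat p d) x)"

definition long_run_mean ::
    "('s::finite \<Rightarrow> 'a::finite \<Rightarrow> 's pmf) \<Rightarrow> ('s \<Rightarrow> 'a \<Rightarrow> real) \<Rightarrow> ('s, 'a) policy \<Rightarrow> real" where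
  "long_run_mean p r d = (\<Sum>i\<in>UNIV. stat_dist p d $ i * r i (d i))"

definition long_run_variance ::
    "('s::finite \<Rightarrow> 'a::finite \<Rightarrow> 's pmf) \<Rightarrow> ('s \<Rightarrow> 'a \<Rightarrow> real) \<Rightarrow> ('s, 'a) policy \<Rightarrow> real" where
  "long_run_variance p r d =
     (\<Sum>i\<in>UNIV. stat_dist p d $ i * (r i (d i) - long_run_mean p r d)\<^sup>2)"

definition mv_objective ::
    "('s::finite \<Rightarrow> 'a::finite \<Rightarrow> 's pmf) \<Rightarrow> ('s \<Rightarrow> 'a \<Rightarrow> real) \<Rightarrow> real \<Rightarrow> ('s, 'a) policy \<Rightarrow> real" where
  "mv_objective p r \<beta> d = \<beta> * long_run_variance p r d - long_run_mean p r d"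

end

theory Submission
  imports Defs
begin

text \<open>
  With \<open>objective = \<beta> * variance - mean\<close>, a policy in the second area is dominated by
  rearranging the inequality that defines the area.  A policy \<open>d\<close> in the first area satisfies
  \<open>- mean d \<ge> \<beta> * variance dstar - mean dstar\<close>, so it is dominated because its variance is
  nonnegative.

  The variance is a sum of squares weighted by \<open>stat_dist\<close>, which is a definite description:
  the weights are known to be nonnegative only once a unichain is shown to have exactly one
  stationary distribution (lemma \<open>unichain_unique_stationary_distribution\<close>).  Existence and
  uniqueness both rest on the fact that the absolute value of an invariant signed measure of a
  stochastic matrix is again invariant (lemma \<open>invariant_abs\<close>).  For existence, \<open>P - mat 1\<close> is
  singular because the rows of \<open>P\<close> sum to \<open>1\<close>, so there is a nonzero invariant signed measure,
  and its normalised absolute value is a stationary distribution.  For uniqueness, the positive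
  and negative parts of the difference of two stationary distributions are invariant, so their
  supports are closed sets of states.  In a unichain some state is accessible from every state
  (lemma \<open>unichain_accessible_from_all\<close>), and so two nonempty closed sets cannot be disjoint.
  Hence the difference has constant sign and total mass \<open>0\<close>, that is, it vanishes.

  A commonly accessible state exists because every state leads to an essential one, that is,
  to one that is accessible from every state it leads to; essential states of a finite chain are recurrent
  (lemma \<open>essential_imp_recurrent\<close>), and a unichain has a single class of recurrent states.
\<close>

section \<open>Accessibility in a finite chain\<close>

definition stochastic :: "real ^ 's ^ ('s::finite) \<Rightarrow> bool" where
  "stochastic P \<longleftrightarrow> (\<forall>i j. 0 \<le> P $ i $ j) \<and> (\<forall>i. (\<Sum>j\<in>UNIV. P $ i $ j) = 1)"

lemma stochasticD:
  assumes "stochastic P"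
  shows "0 \<le> P $ i $ j" and "(\<Sum>j\<in>UNIV. P $ i $ j) = 1"
  using assms by (auto simp: stochastic_def)

lemma stochastic_trans_mat: "stochastic (trans_mat p d)"
  by (simp add: stochastic_def trans_mat_def sum_pmf_eq_1)

definition successors :: "real ^ 's ^ 's \<Rightarrow> ('s::finite) rel" where
  "successors P = {(i, j). 0 < P $ i $ j}"

lemma n_step_nonneg:
  assumes "stochastic P"
  shows "0 \<le> n_step P n $ i $ j"
proof (induction n arbitrary: i)
  case 0
  show ?case by (simp add: mat_def)
next
  case (Suc n)
  then show ?case
    by (simp add: matrix_matrix_mult_def stochasticD(1)[OF assms] sum_nonneg)
qed

lemma n_step_pos_imp_rtrancl:
  assumes P: "stochastic P"
  shows "0 < n_step P n $ i $ j \<Longrightarrow> (i, j) \<in> (successors P)\<^sup>*"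
proof (induction n arbitrary: i)
  case 0
  then show ?case by (simp add: mat_def split: if_splits)
next
  case (Suc n)
  have "0 < (\<Sum>k\<in>UNIV. P $ i $ k * n_step P n $ k $ j)"
    using Suc.prems by (simp add: matrix_matrix_mult_def)
  then obtain k where k: "0 < P $ i $ k * n_step P n $ k $ j"
    by (meson not_le sum_nonpos)
  then have "0 < P $ i $ k" "0 < n_step P n $ k $ j"
    using stochasticD(1)[OF P, of i k] n_step_nonneg[OF P, of n k j]
    by (auto simp: zero_less_mult_iff)
  then show ?case
    using Suc.IH by (auto simp: successors_def intro: converse_rtrancl_into_rtrancl)
qed

lemma accessible_step:
  assumes P: "stochastic P" and step: "0 < P $ i $ k" and acc: "accessible P k j"
  shows "accessible P i j"
proof -
  obtain n where n: "0 < n_step P n $ k $ j"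
    using acc by (auto simp: accessible_def)
  have "0 < P $ i $ k * n_step P n $ k $ j"
    using step n by simp
  also have "\<dots> \<le> (\<Sum>k\<in>UNIV. P $ i $ k * n_step P n $ k $ j)"
    by (rule member_le_sum) (auto simp: stochasticD(1)[OF P] n_step_nonneg[OF P])
  also have "\<dots> = n_step P (Suc n) $ i $ j"
    by (simp add: matrix_matrix_mult_def)
  finally show ?thesis unfolding accessible_def by blast
qed

lemma accessible_refl: "accessible P i i"
  unfolding accessible_def by (rule exI[of _ 0]) (simp add: mat_def)

lemma accessible_iff_rtrancl:
  assumes P: "stochastic P"
  shows "accessible P i j \<longleftrightarrow> (i, j) \<in> (successors P)\<^sup>*"
proof
  show "accessible P i j \<Longrightarrow> (i, j) \<in> (successors P)\<^sup>*"
    using n_step_pos_imp_rtrancl[OF P] by (auto simp: accessible_def)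
  show "(i, j) \<in> (successors P)\<^sup>* \<Longrightarrow> accessible P i j"
    by (induction rule: converse_rtrancl_induct)
       (auto simp: accessible_refl successors_def intro: accessible_step[OF P])
qed

lemma closed_set_accessible:
  assumes P: "stochastic P"
    and closed: "\<And>k l. k \<in> C \<Longrightarrow> 0 < P $ k $ l \<Longrightarrow> l \<in> C"
    and "i \<in> C" "accessible P i j"
  shows "j \<in> C"
proof -
  have "(i, j) \<in> (successors P)\<^sup>*"
    using assms(4) by (simp add: accessible_iff_rtrancl[OF P])
  then show ?thesis
    by (induction rule: rtrancl_induct) (auto simp: successors_def \<open>i \<in> C\<close> intro: closed)
qed

definition essential :: "real ^ 's ^ 's \<Rightarrow> ('s::finite) \<Rightarrow> bool" where
  "essential P j \<longleftrightarrow> (\<forall>k. accessible P j k \<longrightarrow> accessible P k j)"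

text \<open>
  Among the states accessible from \<open>i\<close>, one with the fewest accessible states is essential:
  passing to an accessible state can only shrink the set of accessible states, and by
  minimality it does not.
\<close>

lemma ex_accessible_essential:
  fixes P :: "real ^ 's ^ ('s::finite)"
  assumes P: "stochastic P"
  shows "\<exists>j. accessible P i j \<and> essential P j"
proof -
  define R where "R j = {k. accessible P j k}" for j
  have trans: "accessible P a c" if "accessible P a b" "accessible P b c" for a b c
    using that by (simp add: accessible_iff_rtrancl[OF P])
  obtain j where j: "accessible P i j"
    and min: "\<And>k. accessible P i k \<Longrightarrow> card (R j) \<le> card (R k)"
    using ex_has_least_nat[of "accessible P i" i "\<lambda>j. card (R j)"] accessible_refl by metis
  have "accessible P k j" if k: "accessible P j k" for k
  proof -
    have "R k \<subseteq> R j"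
      unfolding R_def using trans[OF k] by blast
    then have "R k = R j"
      using min[OF trans[OF j k]] by (intro card_seteq) auto
    then show ?thesis
      using accessible_refl[of P j] unfolding R_def by blast
  qed
  then show ?thesis
    using j by (auto simp: essential_def)
qed

section \<open>Recurrence of essential states\<close>

lemma first_visit_nonneg:
  assumes "stochastic P"
  shows "0 \<le> first_visit P n $ i $ j"
  by (induction n arbitrary: i) (auto simp: stochasticD(1)[OF assms] intro!: sum_nonneg)

text \<open>Conditioning on the first step.\<close>

lemma first_visit_partial_sum_Suc:
  "(\<Sum>m<Suc n. first_visit P m $ i $ j) =
     P $ i $ j + (\<Sum>k\<in>UNIV - {j}. P $ i $ k * (\<Sum>m<n. first_visit P m $ k $ j))"
proof -
  have "(\<Sum>m<Suc n. first_visit P m $ i $ j) =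
      P $ i $ j + (\<Sum>m<n. \<Sum>k\<in>UNIV - {j}. P $ i $ k * first_visit P m $ k $ j)"
    by (simp add: sum.lessThan_Suc_shift del: sum.lessThan_Suc)
  then show ?thesis
    by (simp add: sum.swap[of _ "{..<n}"] sum_distrib_left)
qed

lemma row_sum_split:
  assumes "stochastic P"
  shows "P $ i $ j + (\<Sum>k\<in>UNIV - {j}. P $ i $ k) = 1"
  using stochasticD(2)[OF assms, of i] by (simp add: sum.remove[of UNIV j])

lemma first_visit_partial_sum_le_1:
  assumes P: "stochastic P"
  shows "(\<Sum>m<n. first_visit P m $ i $ j) \<le> 1"
proof (induction n arbitrary: i)
  case 0
  show ?case by simp
next
  case (Suc n)
  have "(\<Sum>k\<in>UNIV - {j}. P $ i $ k * (\<Sum>m<n. first_visit P m $ k $ j))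
      \<le> (\<Sum>k\<in>UNIV - {j}. P $ i $ k)"
    by (intro sum_mono mult_left_le Suc.IH stochasticD(1)[OF P])
  then show ?case
    using row_sum_split[OF P, of i j] by (simp only: first_visit_partial_sum_Suc)
qed

lemma summable_first_visit:
  assumes P: "stochastic P"
  shows "summable (\<lambda>n. first_visit P n $ i $ j)"
  by (rule bounded_imp_summable[where B = 1])
     (use first_visit_nonneg[OF P] first_visit_partial_sum_le_1[OF P, of i j "Suc _"]
      in \<open>auto simp: lessThan_Suc_atMost simp del: sum.lessThan_Suc\<close>)

text \<open>
  The probability, starting in \<open>i\<close>, of not visiting \<open>j\<close> at any positive time.  Time \<open>0\<close> does
  not count, so for \<open>i = j\<close> it is the probability of never returning.
\<close>

definition avoid_prob :: "real ^ 's ^ 's \<Rightarrow> ('s::finite) \<Rightarrow> 's \<Rightarrow> real" where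
  "avoid_prob P j i = 1 - (\<Sum>n. first_visit P n $ i $ j)"

lemma avoid_prob_nonneg:
  assumes P: "stochastic P"
  shows "0 \<le> avoid_prob P j i"
  unfolding avoid_prob_def
  using suminf_le_const[OF summable_first_visit[OF P] first_visit_partial_sum_le_1[OF P]]
  by simp

lemma avoid_prob_first_step:
  assumes P: "stochastic P"
  shows "avoid_prob P j i = (\<Sum>k\<in>UNIV - {j}. P $ i $ k * avoid_prob P j k)"
proof -
  define F where "F k = (\<Sum>n. first_visit P n $ k $ j)" for k
  have lim: "(\<lambda>n. \<Sum>m<n. first_visit P m $ k $ j) \<longlonglongrightarrow> F k" for k
    unfolding F_def by (rule summable_LIMSEQ[OF summable_first_visit[OF P]])
  have "(\<lambda>n. \<Sum>m<Suc n. first_visit P m $ i $ j)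
      \<longlonglongrightarrow> P $ i $ j + (\<Sum>k\<in>UNIV - {j}. P $ i $ k * F k)"
    unfolding first_visit_partial_sum_Suc by (intro tendsto_intros lim)
  then have "F i = P $ i $ j + (\<Sum>k\<in>UNIV - {j}. P $ i $ k * F k)"
    using LIMSEQ_unique LIMSEQ_Suc[OF lim] by blast
  then show ?thesis
    using row_sum_split[OF P, of i j]
    by (simp add: avoid_prob_def F_def[symmetric] right_diff_distrib sum_subtractf)
qed

text \<open>
  Maximum principle.  Let \<open>M\<close> be the largest probability, over the states accessible from \<open>j\<close>,
  of not visiting \<open>j\<close> at any positive time, and suppose \<open>M > 0\<close>.  Since this probability is averaged over the
  next state, with the value \<open>0\<close> for a step into \<open>j\<close>, every successor of a maximising state is
  different from \<open>j\<close> and again maximising.  So \<open>j\<close> is not accessible from the successors of a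
  maximising state, although \<open>j\<close> is essential.
\<close>

lemma essential_imp_recurrent:
  assumes P: "stochastic P" and ess: "essential P j"
  shows "recurrent P j"
proof -
  let ?s = "avoid_prob P j"
  define R where "R = {k. accessible P j k}"
  have R_step: "l \<in> R" if "k \<in> R" "0 < P $ k $ l" for k l
    using that by (auto simp: R_def accessible_iff_rtrancl[OF P] successors_def
        intro: rtrancl_into_rtrancl)
  have "j \<in> R"
    by (simp add: R_def accessible_refl)
  define M where "M = Max (?s ` R)"
  have s_le: "?s k \<le> M" if "k \<in> R" for k
    using that by (simp add: M_def)
  obtain m where m: "m \<in> R" "?s m = M"
    using Max_in[of "?s ` R"] \<open>j \<in> R\<close> unfolding M_def by fastforce
  have "M \<le> 0"
  proof (rule ccontr)
    assume "\<not> M \<le> 0"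
    define A where "A = {k \<in> R. k \<noteq> j \<and> ?s k = M}"
    have succ: "l \<in> A" if k: "k \<in> R" "?s k = M" and kl: "0 < P $ k $ l" for k l
    proof -
      define g where "g l = P $ k $ l * (M - (if l = j then 0 else ?s l))" for l
      have "(\<Sum>l\<in>UNIV. P $ k $ l * (if l = j then 0 else ?s l)) = ?s k"
        unfolding avoid_prob_first_step[OF P, of j k]
        by (rule sum.mono_neutral_cong_right) auto
      then have "(\<Sum>l\<in>UNIV. g l) = 0"
        using stochasticD(2)[OF P, of k] k(2)
        by (simp add: g_def right_diff_distrib sum_subtractf flip: sum_distrib_right)
      moreover have "0 \<le> g l" for l
      proof (cases "0 < P $ k $ l")
        case True
        then show ?thesis
          using s_le[OF R_step[OF k(1) True]] \<open>\<not> M \<le> 0\<close> by (simp add: g_def)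
      next
        case False
        then have "P $ k $ l = 0"
          using stochasticD(1)[OF P, of k l] by simp
        then show ?thesis by (simp add: g_def)
      qed
      ultimately have "g l = 0"
        by (simp add: sum_nonneg_eq_0_iff)
      then show ?thesis
        using kl \<open>\<not> M \<le> 0\<close> R_step[OF k(1) kl] by (auto simp: g_def A_def split: if_splits)
    qed
    have "\<exists>l. 0 < P $ m $ l"
      using stochasticD(2)[OF P, of m] by (metis not_le sum_nonpos zero_less_one)
    then obtain l where l: "l \<in> A"
      using succ[OF m] by blast
    then have "accessible P l j"
      using ess by (auto simp: A_def R_def essential_def)
    have A_closed: "l' \<in> A" if "k \<in> A" "0 < P $ k $ l'" for k l'
      by (rule succ[OF _ _ that(2)]) (use that(1) in \<open>simp_all add: A_def\<close>)
    have "j \<in> A"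
      by (rule closed_set_accessible[OF P A_closed l \<open>accessible P l j\<close>])
    then show False
      by (simp add: A_def)
  qed
  then have "?s j = 0"
    using s_le[OF \<open>j \<in> R\<close>] avoid_prob_nonneg[OF P, of j j] by simp
  then show ?thesis
    using summable_sums[OF summable_first_visit[OF P, of j j]]
    by (simp add: recurrent_def avoid_prob_def)
qed

lemma unichain_accessible_from_all:
  assumes P: "stochastic P" and "unichain P"
  shows "\<exists>x. \<forall>i. accessible P i x"
proof -
  obtain x where x: "{i. recurrent P i} = communication P `` {x}"
    using \<open>unichain P\<close> by (auto simp: unichain_def quotient_def)
  have "accessible P i x" for i
  proof -
    obtain j where j: "accessible P i j" "essential P j"
      using ex_accessible_essential[OF P] by blast
    then have "accessible P j x"
      using x essential_imp_recurrent[OF P j(2)] by (auto simp: communication_def)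
    with j(1) show ?thesis
      by (simp add: accessible_iff_rtrancl[OF P])
  qed
  then show ?thesis by blast
qed

section \<open>Invariant measures and the stationary distribution\<close>

lemma vector_matrix_mult_nth:
  fixes P :: "real ^ 's ^ ('s::finite)"
  shows "(z v* P) $ j = (\<Sum>i\<in>UNIV. z $ i * P $ i $ j)"
  by (simp add: vector_matrix_mult_def)

text \<open>
  The triangle inequality gives \<open>\<bar>z\<bar> \<le> \<bar>z\<bar> P\<close> in each coordinate; both sides have the same
  total mass, so they agree.
\<close>

lemma invariant_abs:
  fixes P :: "real ^ 's ^ ('s::finite)"
  assumes P: "stochastic P" and z: "z v* P = z"
  shows "(\<chi> i. \<bar>z $ i\<bar>) v* P = (\<chi> i. \<bar>z $ i\<bar>)"
proof -
  define g where "g j = (\<Sum>i\<in>UNIV. \<bar>z $ i\<bar> * P $ i $ j) - \<bar>z $ j\<bar>" for j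
  have "0 \<le> g j" for j
  proof -
    have "\<bar>z $ j\<bar> = \<bar>\<Sum>i\<in>UNIV. z $ i * P $ i $ j\<bar>"
      using arg_cong[OF z, of "\<lambda>v. v $ j"] by (simp add: vector_matrix_mult_nth)
    also have "\<dots> \<le> (\<Sum>i\<in>UNIV. \<bar>z $ i * P $ i $ j\<bar>)"
      by (rule sum_abs)
    finally show ?thesis
      using stochasticD(1)[OF P] by (simp add: g_def abs_mult)
  qed
  moreover have "(\<Sum>j\<in>UNIV. g j) = 0"
  proof -
    have "(\<Sum>j\<in>UNIV. \<Sum>i\<in>UNIV. \<bar>z $ i\<bar> * P $ i $ j) = (\<Sum>i\<in>UNIV. \<bar>z $ i\<bar>)"
      by (subst sum.swap) (simp add: stochasticD(2)[OF P] flip: sum_distrib_left)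
    then show ?thesis by (simp add: g_def sum_subtractf)
  qed
  ultimately have "g j = 0" for j
    by (simp add: sum_nonneg_eq_0_iff)
  then show ?thesis
    by (simp add: vec_eq_iff vector_matrix_mult_nth g_def)
qed

text \<open>
  The support of an invariant measure is closed: a transition out of a state of positive mass
  carries positive mass to its target.
\<close>

lemma nonneg_invariant_pos_if_accessible:
  fixes P :: "real ^ 's ^ ('s::finite)"
  assumes P: "stochastic P" and inv: "w v* P = w" and nonneg: "\<And>i. 0 \<le> w $ i"
    and "0 < w $ i" "accessible P i j"
  shows "0 < w $ j"
proof -
  have "0 < w $ l" if "0 < w $ k" "0 < P $ k $ l" for k l
  proof -
    have "0 < w $ k * P $ k $ l"
      using that by simp
    also have "\<dots> \<le> (\<Sum>i\<in>UNIV. w $ i * P $ i $ l)"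
      by (rule member_le_sum) (auto simp: nonneg stochasticD(1)[OF P])
    also have "\<dots> = w $ l"
      using arg_cong[OF inv, of "\<lambda>v. v $ l"] by (simp add: vector_matrix_mult_nth)
    finally show ?thesis .
  qed
  then have "j \<in> {k. 0 < w $ k}"
    using \<open>0 < w $ i\<close> by (intro closed_set_accessible[OF P _ _ \<open>accessible P i j\<close>]) auto
  then show ?thesis by simp
qed

text \<open>
  The vectors \<open>\<bar>z\<bar> + z\<close> and \<open>\<bar>z\<bar> - z\<close> are invariant and nonnegative, and their supports are
  disjoint.  If both were nonzero, both would be positive at a state that is accessible from
  everywhere.
\<close>

lemma invariant_sum_0_eq_0:
  fixes P :: "real ^ 's ^ ('s::finite)"
  assumes P: "stochastic P" and x: "\<And>i. accessible P i x"
    and z: "z v* P = z" and sum0: "(\<Sum>i\<in>UNIV. z $ i) = 0"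
  shows "z = 0"
proof -
  define a where "a = (\<chi> i. \<bar>z $ i\<bar>)"
  have a: "a v* P = a"
    unfolding a_def by (rule invariant_abs[OF P z])
  have "(a + z) v* P = a + z"
    using a z by (simp add: vec_eq_iff vector_matrix_mult_nth distrib_right sum.distrib)
  then have pos: "0 < (a + z) $ x" if "0 < z $ i" for i
    by (rule nonneg_invariant_pos_if_accessible[OF P _ _ _ x[of i]]) (use that in \<open>auto simp: a_def\<close>)
  have "(a - z) v* P = a - z"
    using a z by (simp add: vec_eq_iff vector_matrix_mult_nth left_diff_distrib sum_subtractf)
  then have neg: "0 < (a - z) $ x" if "z $ i < 0" for i
    by (rule nonneg_invariant_pos_if_accessible[OF P _ _ _ x[of i]]) (use that in \<open>auto simp: a_def\<close>)
  have "(\<forall>i. z $ i \<le> 0) \<or> (\<forall>i. 0 \<le> z $ i)"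
  proof (rule ccontr)
    assume "\<not> ?thesis"
    then obtain i k where "0 < z $ i" "z $ k < 0"
      by (auto simp: not_le)
    then show False
      using pos[of i] neg[of k] by (simp add: a_def)
  qed
  then show ?thesis
  proof
    assume "\<forall>i. z $ i \<le> 0"
    moreover have "(\<Sum>i\<in>UNIV. - (z $ i)) = 0"
      using sum0 by (simp add: sum_negf)
    ultimately show ?thesis
      using sum_nonneg_eq_0_iff[of UNIV "\<lambda>i. - (z $ i)"] by (simp add: vec_eq_iff)
  next
    assume "\<forall>i. 0 \<le> z $ i"
    then show ?thesis
      using sum0 sum_nonneg_eq_0_iff[of UNIV "\<lambda>i. z $ i"] by (simp add: vec_eq_iff)
  qed
qed

text \<open>
  The constant vector \<open>1\<close> lies in the kernel of \<open>P - mat 1\<close>, so this square matrix also has a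
  nontrivial left kernel.
\<close>

lemma ex_nonzero_invariant:
  fixes P :: "real ^ 's ^ ('s::finite)"
  assumes P: "stochastic P"
  shows "\<exists>z. z \<noteq> 0 \<and> z v* P = z"
proof -
  let ?A = "P - mat 1"
  have "?A *v 1 = 0"
    using stochasticD(2)[OF P]
    by (simp add: matrix_vector_mult_diff_rdistrib) (simp add: vec_eq_iff matrix_vector_mult_def)
  moreover have "(1 :: real ^ 's) \<noteq> 0"
    by (simp add: vec_eq_iff)
  ultimately have "\<not> invertible ?A"
    by (metis invertible_left_inverse matrix_left_invertible_ker)
  then have "\<not> invertible (transpose ?A)"
    by (simp add: invertible_det_nz)
  then obtain z where "z \<noteq> 0" "transpose ?A *v z = 0"
    by (metis invertible_left_inverse matrix_left_invertible_ker)
  then have "z v* ?A = 0"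
    by (simp add: transpose_matrix_vector)
  then have "z v* P = z"
    by (simp add: vector_matrix_mult_diff_rdistrib)
  then show ?thesis
    using \<open>z \<noteq> 0\<close> by blast
qed

lemma ex_stationary_distribution:
  fixes P :: "real ^ 's ^ ('s::finite)"
  assumes P: "stochastic P"
  shows "\<exists>x. stationary_distribution P x"
proof -
  obtain z where z: "z \<noteq> 0" "z v* P = z"
    using ex_nonzero_invariant[OF P] by blast
  define a where "a = (\<chi> i. \<bar>z $ i\<bar>)"
  define c where "c = (\<Sum>i\<in>UNIV. \<bar>z $ i\<bar>)"
  have "c \<noteq> 0"
    using z(1) by (simp add: c_def sum_nonneg_eq_0_iff vec_eq_iff)
  then have "0 < c"
    by (simp add: c_def sum_nonneg less_le)
  have a: "a v* P = a"
    unfolding a_def by (rule invariant_abs[OF P z(2)])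
  have "stationary_distribution P (\<chi> i. a $ i / c)"
    unfolding stationary_distribution_def
  proof (intro conjI allI)
    show "0 \<le> (\<chi> i. a $ i / c) $ i" for i
      using \<open>0 < c\<close> by (simp add: a_def)
    show "(\<Sum>i\<in>UNIV. (\<chi> i. a $ i / c) $ i) = 1"
      using \<open>0 < c\<close> by (simp add: a_def c_def flip: sum_divide_distrib)
    show "(\<chi> i. a $ i / c) v* P = (\<chi> i. a $ i / c)"
      using a by (simp add: vec_eq_iff vector_matrix_mult_nth flip: sum_divide_distrib)
  qed
  then show ?thesis by blast
qed

lemma unichain_unique_stationary_distribution:
  fixes P :: "real ^ 's ^ ('s::finite)"
  assumes P: "stochastic P" and "unichain P"
  shows "\<exists>!x. stationary_distribution P x"
proof (rule ex_ex1I[OF ex_stationary_distribution[OF P]])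
  fix x y
  assume x: "stationary_distribution P x" and y: "stationary_distribution P y"
  obtain s where s: "\<And>i. accessible P i s"
    using unichain_accessible_from_all[OF assms] by blast
  have "(x - y) v* P = x - y"
    using x y by (simp add: stationary_distribution_def vec_eq_iff vector_matrix_mult_nth
        left_diff_distrib sum_subtractf)
  moreover have "(\<Sum>i\<in>UNIV. (x - y) $ i) = 0"
    using x y by (simp add: stationary_distribution_def sum_subtractf)
  ultimately have "x - y = 0"
    by (rule invariant_sum_0_eq_0[OF P s])
  then show "x = y" by simp
qed

section \<open>Dominated policies\<close>

lemma long_run_variance_nonneg:
  assumes "unichain (trans_mat p d)"
  shows "0 \<le> long_run_variance p r d"
proof -
  have "stationary_distribution (trans_mat p d) (stat_dist p d)"
    unfolding stat_dist_def
    by (rule theI'[OF unichain_unique_stationary_distribution[OF stochastic_trans_mat assms]])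
  then show ?thesis
    by (auto simp: stationary_distribution_def long_run_variance_def intro!: sum_nonneg)
qed

theorem lemma5:
  fixes p :: "'s::finite \<Rightarrow> 'a::finite \<Rightarrow> 's pmf"
    and r :: "'s \<Rightarrow> 'a \<Rightarrow> real"
    and \<beta> :: real
    and dstar d :: "('s, 'a) policy"
  assumes unichain: "\<And>e :: ('s, 'a) policy. unichain (trans_mat p e)"
    and beta_pos: "\<beta> > 0"
    and area:
      "long_run_mean p r d
           \<in> {.. long_run_mean p r dstar - \<beta> * long_run_variance p r dstar}
       \<or> long_run_mean p r d
           \<in> {long_run_mean p r dstar - \<beta> * long_run_variance p r dstar ..}
         \<and> long_run_variance p r d
           \<in> {long_run_variance p r dstar
               + 1 / \<beta> * (long_run_mean p r d - long_run_mean p r dstar) ..}"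
  shows "mv_objective p r \<beta> dstar \<le> mv_objective p r \<beta> d"
  using area
proof (elim disjE conjE)
  assume "long_run_mean p r d
      \<in> {.. long_run_mean p r dstar - \<beta> * long_run_variance p r dstar}"
  moreover have "0 \<le> \<beta> * long_run_variance p r d"
    using beta_pos long_run_variance_nonneg[OF unichain] by simp
  ultimately show ?thesis
    by (simp add: mv_objective_def)
next
  assume "long_run_variance p r d
      \<in> {long_run_variance p r dstar
           + 1 / \<beta> * (long_run_mean p r d - long_run_mean p r dstar) ..}"
  then show ?thesis
    using beta_pos by (simp add: mv_objective_def field_simps)
qed

end
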